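(* Let $\mathbb{F}$ be a field. Up to isomorphism there is a unique nilpotent symplectic alternating algebra $L$ over $\mathbb{F}$ of dimension $10$ with an isotropic center $Z(L)$ of dimension $4$ such that $L^{3}=Z(L)$ and $L$ is of type A. This algebra can be given by the presentation $$\mathcal{P}_{10}^{(4,2)}:\ (x_{1}y_{2},y_{3})=1,\ (y_{1}y_{4},y_{5})=1.$$
   Context: A symplectic alternating algebra (SAA) over a field $\mathbb{F}$ is a finite-dimensional $\mathbb{F}$-vector space $L$ with a non-degenerate alternating bilinear form $(\cdot,\cdot)$ and a bilinear alternating product $L\times L\to L$, $(x,y)\mapsto xy$ (so $xx=0$), such that $(xy,z)=(yz,x)$ for all $x,y,z\in L$. Consequently $(u,v,w)\mapsto (uv,w)$ is an alternating trilinear form, and by non-degeneracy it determines the product. An isomorphism of SAAs is a linear bijection preserving both the product and the form. For subspaces $U,V\le L$, $UV$ denotes the linear span of all products $uv$ with $u\in U$, $v\in V$. Put $L^{1}=L$, $L^{k+1}=L^{k}L$; $L$ is nilpotent if $L^{k+1}=0$ for some $k$. The center is $Z(L)=\{z\in L: zx=0 \text{ for all } x\in L\}$. A subspace $U$ is isotropic if $(u,v)=0$ for all $u,v\in U$. A standard basis of a $10$-dimensional $L$ is a basis $x_{1},y_{1},\ldots,x_{5},y_{5}$ with $(x_i,x_j)=(y_i,y_j)=0$ and $(x_i,y_j)=\delta_{ij}$. A nilpotent presentation lists values of the triples $(x_iy_j,y_k)$ and $(y_iy_j,y_k)$ with $1\le i<j<k\le 5$ with respect to a standard basis. By convention, all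 triple values $(uv,w)$ of basis vectors $u,v,w$ which do not follow from the listed ones by the alternating property are $0$. Such a presentation determines an SAA up to isomorphism. Let $L$ be a nilpotent SAA of dimension $10$ with isotropic center of dimension $4$ and $L^{3}=Z(L)$. Then $L^{2}/Z(L)$ is $2$-dimensional, $L/L^{2}$ is $4$-dimensional and $L^2$ is abelian. For $\bar z=z+Z(L)\in L^{2}/Z(L)$ one has the well-defined alternating form $\phi_{\bar z}:L/L^{2}\times L/L^{2}\to\mathbb{F}$, $\phi_{\bar z}(u+L^{2},v+L^{2})=(zu,v)$. $L$ is of type A if there is a basis $\bar z,\bar t$ of $L^{2}/Z(L)$ such that $\phi_{\bar z}$ and $\phi_{\bar t}$ are both degenerate. *)

theory Defs
  imports "HOL-Analysis.Cartesian_Space" "HOL-Library.Numeral_Type" "HOL-Library.Multiset"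
begin

locale symplectic_alternating_algebra = vector_space scale
  for scale :: "'f::field \<Rightarrow> 'v::ab_group_add \<Rightarrow> 'v" +
  fixes form :: "'v \<Rightarrow> 'v \<Rightarrow> 'f"
    and mul :: "'v \<Rightarrow> 'v \<Rightarrow> 'v"  (infixl "\<star>" 70)
  assumes finite_dimensional: "\<exists>B. finite B \<and> span B = UNIV"
    and form_add_left: "form (u + v) w = form u w + form v w"
    and form_add_right: "form u (v + w) = form u v + form u w"
    and form_scale_left: "form (scale a u) v = a * form u v"
    and form_scale_right: "form u (scale a v) = a * form u v"
    and form_alternating: "form u u = 0"
    and form_nondegenerate: "(\<And>v. form u v = 0) \<Longrightarrow> u = 0"
    and mul_add_left: "(u + v) \<star> w = u \<star> w + v \<star> w"
    and mul_add_right: "u \<star> (v + w) = u \<star> v + u \<star> w"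
    and mul_scale_left: "scale a u \<star> v = scale a (u \<star> v)"
    and mul_scale_right: "u \<star> scale a v = scale a (u \<star> v)"
    and mul_alternating: "u \<star> u = 0"
    and form_mul_cyclic: "form (u \<star> v) w = form (v \<star> w) u"
begin

definition subspace_mul :: "'v set \<Rightarrow> 'v set \<Rightarrow> 'v set" where
  "subspace_mul U V = span {u \<star> v | u v. u \<in> U \<and> v \<in> V}"

text \<open>The lower central series is indexed from \<open>1\<close>; the value at \<open>0\<close> is a dummy.\<close>

fun lower_central :: "nat \<Rightarrow> 'v set" where
  "lower_central 0 = UNIV"
| "lower_central (Suc 0) = UNIV"
| "lower_central (Suc (Suc k)) = subspace_mul (lower_central (Suc k)) UNIV"

definition nilpotent :: bool where
  "nilpotent \<longleftrightarrow> (\<exists>k\<ge>1. lower_central (k + 1) = {0})"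

definition center :: "'v set" where
  "center = {z. \<forall>x. z \<star> x = 0}"

definition isotropic :: "'v set \<Rightarrow> bool" where
  "isotropic U \<longleftrightarrow> (\<forall>u\<in>U. \<forall>v\<in>U. form u v = 0)"

text \<open>Elements of a quotient \<open>W/U\<close> are cosets, so its zero element is \<open>U\<close>.\<close>

definition quotient_space :: "'v set \<Rightarrow> 'v set \<Rightarrow> 'v set set" where
  "quotient_space W U = (\<lambda>w. {w + u | u. u \<in> U}) ` W"

definition coset_add :: "'v set \<Rightarrow> 'v set \<Rightarrow> 'v set" where
  "coset_add C D = {c + d | c d. c \<in> C \<and> d \<in> D}"

text \<open>Adding \<open>U\<close> makes the scalar multiple by \<open>0\<close> equal to \<open>U\<close> instead of \<open>{0}\<close>.\<close>

definition coset_scale :: "'v set \<Rightarrow> 'f \<Rightarrow> 'v set \<Rightarrow> 'v set" where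
  "coset_scale U a C = {scale a c + u | c u. c \<in> C \<and> u \<in> U}"

definition quotient_basis_pair :: "'v set \<Rightarrow> 'v set \<Rightarrow> 'v set \<Rightarrow> 'v set \<Rightarrow> bool" where
  "quotient_basis_pair W U B C \<longleftrightarrow>
     B \<in> quotient_space W U \<and> C \<in> quotient_space W U \<and>
     (\<forall>D \<in> quotient_space W U.
        \<exists>!p. D = coset_add (coset_scale U (fst p) B) (coset_scale U (snd p) C))"

text \<open>For \<open>D \<in> L\<^sup>2/Z(L)\<close> and \<open>M, N \<in> L/L\<^sup>2\<close> the value \<open>(zu, v)\<close> is independent of the
  representatives \<open>z \<in> D\<close>, \<open>u \<in> M\<close>, \<open>v \<in> N\<close> whenever \<open>L\<^sup>3 = Z(L)\<close>.\<close>

definition phi :: "'v set \<Rightarrow> 'v set \<Rightarrow> 'v set \<Rightarrow> 'f" where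
  "phi D M N = (THE c. \<forall>z\<in>D. \<forall>u\<in>M. \<forall>v\<in>N. form (z \<star> u) v = c)"

definition phi_degenerate :: "'v set \<Rightarrow> bool" where
  "phi_degenerate D \<longleftrightarrow>
     (\<exists>M \<in> quotient_space UNIV (lower_central 2). M \<noteq> lower_central 2 \<and>
        (\<forall>N \<in> quotient_space UNIV (lower_central 2). phi D M N = 0))"

definition type_A :: bool where
  "type_A \<longleftrightarrow> (\<exists>B C. quotient_basis_pair (lower_central 2) center B C \<and>
     phi_degenerate B \<and> phi_degenerate C)"

definition standard_basis :: "nat \<Rightarrow> (nat \<Rightarrow> 'v) \<Rightarrow> (nat \<Rightarrow> 'v) \<Rightarrow> bool" where
  "standard_basis n x y \<longleftrightarrow>
     card (x ` {1..n} \<union> y ` {1..n}) = 2 * n \<and>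
     independent (x ` {1..n} \<union> y ` {1..n}) \<and>
     span (x ` {1..n} \<union> y ` {1..n}) = UNIV \<and>
     (\<forall>i\<in>{1..n}. \<forall>j\<in>{1..n}. form (x i) (x j) = 0 \<and> form (y i) (y j) = 0 \<and>
        form (x i) (y j) = (if i = j then 1 else 0))"

end

datatype basis_label = X nat | Y nat

primrec basis_vector :: "(nat \<Rightarrow> 'v) \<Rightarrow> (nat \<Rightarrow> 'v) \<Rightarrow> basis_label \<Rightarrow> 'v" where
  "basis_vector x y (X i) = x i"
| "basis_vector x y (Y i) = y i"

text \<open>An entry \<open>((p, q, r), c)\<close> of a presentation states that \<open>(uv, w) = c\<close> for the basis vectors
  \<open>u, v, w\<close> labelled \<open>p, q, r\<close>.\<close>

type_synonym 'f presentation = "((basis_label \<times> basis_label \<times> basis_label) \<times> 'f) set"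

text \<open>The triples whose value follows from a listed one by the alternating property are exactly
  its rearrangements and those with a repeated entry (which have value \<open>0\<close> anyway).\<close>

definition (in symplectic_alternating_algebra) presented_by :: "nat \<Rightarrow> 'f presentation \<Rightarrow> bool" where
  "presented_by n P \<longleftrightarrow> (\<exists>x y. standard_basis n x y \<and>
     (let b = basis_vector x y; labels = X ` {1..n} \<union> Y ` {1..n} in
       (\<forall>((p, q, r), c) \<in> P. form (b p \<star> b q) (b r) = c) \<and>
       (\<forall>p\<in>labels. \<forall>q\<in>labels. \<forall>r\<in>labels.
          (\<forall>((p', q', r'), c) \<in> P. {#p, q, r#} \<noteq> {#p', q', r'#}) \<longrightarrow>
          form (b p \<star> b q) (b r) = 0)))"

definition P_10_4_2 :: "'f::field presentation" where
  "P_10_4_2 = {((X 1, Y 2, Y 3), 1), ((Y 1, Y 4, Y 5), 1)}"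

locale nilpotent_saa_10_4_type_A = symplectic_alternating_algebra +
  assumes dim_10: "dim UNIV = 10"
    and nilpotent: "nilpotent"
    and isotropic_center: "isotropic center"
    and dim_center: "dim center = 4"
    and third_power: "lower_central 3 = center"
    and type_A: "type_A"

definition saa_isomorphic ::
  "('f::field \<Rightarrow> 'v::ab_group_add \<Rightarrow> 'v) \<Rightarrow> ('v \<Rightarrow> 'v \<Rightarrow> 'f) \<Rightarrow> ('v \<Rightarrow> 'v \<Rightarrow> 'v) \<Rightarrow>
   ('f \<Rightarrow> 'w::ab_group_add \<Rightarrow> 'w) \<Rightarrow> ('w \<Rightarrow> 'w \<Rightarrow> 'f) \<Rightarrow> ('w \<Rightarrow> 'w \<Rightarrow> 'w) \<Rightarrow> bool" where
  "saa_isomorphic scale1 form1 mul1 scale2 form2 mul2 \<longleftrightarrow>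
     (\<exists>f. Vector_Spaces.linear scale1 scale2 f \<and> bij f \<and>
        (\<forall>u v. f (mul1 u v) = mul2 (f u) (f v)) \<and>
        (\<forall>u v. form2 (f u) (f v) = form1 u v))"

end

(*
  Write T(u,v,w) = (uv,w). Since L^2 is the orthogonal complement of Z = Z(L), it is abelian.
  Lift the basis of L^2/Z to z, t with (z,t) = 1. Degeneracy forces zL and tL to be of
  dimension 2, and zL + tL = L^3 = Z, so Z is the direct sum of the two. Vectors d_2,...,d_5 dual
  to a suitable basis x_2,...,x_5 of Z then have zd_2 = x_3, zd_3 = -x_2, td_4 = x_5, td_5 = -x_4,
  all other zd_i, td_i being 0. Adding multiples of z to d_4, d_5 and of t to d_2, d_3 kills all
  T(d_i,d_j,d_k). Adding central elements changes no value of T, and such corrections, first of z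
  and t and then of the d_i, produce a standard basis, in which T has the values of the presentation.
*)
theory Submission imports Defs begin

text \<open>Multiplication by a fixed element is self-adjoint for the form: (zu,v) = -(zv,u) =
  (u,zv). Hence zd is determined by the pairings of d with the image of z, which is what turns dual
  vectors d_i into explicit products. Once these products are fixed, the four values T(d_i,d_j,d_k)
  are the only parameters left in T, and there is one scalar correction for each of them. This
  normal form yields uniqueness only. Existence needs a model, taken as a coordinate algebra on
  F^10; the isomorphism for uniqueness is then the coordinate map of the constructed basis onto this
  model.\<close>

context symplectic_alternating_algebra
begin

section \<open>Sign rules for the form and the product\<close>

lemma form_zero_left [simp]: "form 0 v = 0"
  using form_scale_left[of 0 0 v] by simp

lemma form_zero_right [simp]: "form v 0 = 0"
  using form_scale_right[of v 0 0] by simp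

lemma form_minus_left: "form (- u) v = - form u v"
  using form_scale_left[of "-1" u v] by simp

lemma form_minus_right: "form u (- v) = - form u v"
  using form_scale_right[of u "-1" v] by simp

lemma form_diff_left: "form (u - v) w = form u w - form v w"
  using form_add_left[of u "- v" w] by (simp add: form_minus_left)

lemma form_diff_right: "form u (v - w) = form u v - form u w"
  using form_add_right[of u v "- w"] by (simp add: form_minus_right)

lemma mul_zero_left [simp]: "0 \<star> v = 0"
  using mul_scale_left[of 0 0 v] by simp

lemma mul_zero_right [simp]: "v \<star> 0 = 0"
  using mul_scale_right[of v 0 0] by simp

lemma mul_minus_left: "(- u) \<star> v = - (u \<star> v)"
  using mul_scale_left[of "-1" u v] by simp

lemma mul_minus_right: "u \<star> (- v) = - (u \<star> v)"
  using mul_scale_right[of u "-1" v] by simp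

lemma mul_diff_left: "(u - v) \<star> w = u \<star> w - v \<star> w"
  using mul_add_left[of u "- v" w] by (simp add: mul_minus_left)

lemma mul_diff_right: "u \<star> (v - w) = u \<star> v - u \<star> w"
  using mul_add_right[of u v "- w"] by (simp add: mul_minus_right)

lemmas form_linear = form_add_left form_add_right form_diff_left form_diff_right
  form_minus_left form_minus_right form_scale_left form_scale_right

lemmas mul_linear = mul_add_left mul_add_right mul_diff_left mul_diff_right
  mul_minus_left mul_minus_right mul_scale_left mul_scale_right

lemma form_skew: "form u v = - form v u"
  using form_alternating[of "u + v"] form_alternating[of u] form_alternating[of v]
  by (simp add: form_add_left form_add_right eq_neg_iff_add_eq_0 add.commute)

lemma form_eq_swap: "form v u = - a \<Longrightarrow> form u v = a"
  using form_skew[of u v] by simp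

lemma form_swap_value: "form u v = a \<Longrightarrow> form v u = - a"
  using form_skew[of v u] by simp

lemma mul_skew: "u \<star> v = - (v \<star> u)"
  using mul_alternating[of "u + v"] mul_alternating[of u] mul_alternating[of v]
  by (simp add: mul_add_left mul_add_right eq_neg_iff_add_eq_0 add.commute)

text \<open>One transposition; with \<open>form_mul_cyclic\<close> it yields every rearrangement of
  a triple value, up to sign.\<close>

lemma form_mul_swap: "form (u \<star> v) w = - form (u \<star> w) v"
  by (metis form_mul_cyclic form_minus_left mul_skew)

lemma form_eqI: "(\<And>w. form u w = form v w) \<Longrightarrow> u = v"
  using form_nondegenerate[of "u - v"] by (simp add: form_diff_left)

section \<open>Orthogonality and separation of vectors by the form\<close>

lemma subspace_left_perp: "subspace {u. \<forall>w\<in>W. form u w = 0}"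
  by (auto simp: subspace_def form_add_left form_scale_left)

lemma perp_span_left:
  assumes "\<And>s. s \<in> S \<Longrightarrow> form s w = 0" and "u \<in> span S"
  shows "form u w = 0"
  using span_minimal[OF _ subspace_left_perp, of S "{w}"] assms by auto

text \<open>Nondegeneracy settles the empty set, and the induction step is the elimination by which
  dual bases are built.\<close>

lemma separating_vector_finite:
  assumes "finite S" and "v \<notin> span S"
  shows "\<exists>w. (\<forall>s\<in>S. form s w = 0) \<and> form v w = 1"
  using assms
proof (induction S arbitrary: v rule: finite_induct)
  case empty
  then obtain w where "form v w \<noteq> 0"
    using form_nondegenerate[of v] by auto
  then show ?case
    by (intro exI[of _ "scale (inverse (form v w)) w"]) (simp add: form_scale_right)
next
  case (insert s S)
  show ?case
  proof (cases "s \<in> span S")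
    case True
    then have "v \<notin> span S"
      using insert.prems by (simp add: span_redundant)
    then obtain w where w: "\<forall>s\<in>S. form s w = 0" "form v w = 1"
      using insert.IH by blast
    then show ?thesis
      using perp_span_left[of S w s] True by auto
  next
    case False
    then obtain p where p: "\<forall>s\<in>S. form s p = 0" "form s p = 1"
      using insert.IH by blast
    \<comment> \<open>The shift is chosen because (v, q - (s,q)p) = (v - (v,p)s, q), while q -
      (s,q)p is orthogonal to \<open>s\<close>.\<close>
    have "v - scale (form v p) s \<notin> span S"
      using insert.prems span_breakdown_eq by blast
    then obtain q where q: "\<forall>s\<in>S. form s q = 0" "form (v - scale (form v p) s) q = 1"
      using insert.IH by blast
    have "form v (q - scale (form s q) p) = 1"
      using q(2) by (simp add: form_linear mult.commute)
    then show ?thesis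
      using p q(1) by (intro exI[of _ "q - scale (form s q) p"]) (simp add: form_linear)
  qed
qed

lemma finite_independent: "independent S \<Longrightarrow> finite S"
proof -
  obtain B where "finite B" "span B = UNIV"
    using finite_dimensional by blast
  then show "independent S \<Longrightarrow> finite S"
    using independent_span_bound[of B S] by auto
qed

lemma separating_vector:
  assumes "subspace U" and "v \<notin> U"
  shows "\<exists>w. (\<forall>u\<in>U. form u w = 0) \<and> form v w = 1"
proof -
  obtain B where B: "B \<subseteq> U" "independent B" "U \<subseteq> span B"
    using maximal_independent_subset by blast
  then have "span B = U"
    using assms(1) span_minimal by blast
  then show ?thesis
    using separating_vector_finite[OF finite_independent[OF B(2)], of v] assms(2)
      perp_span_left[of B] by blast
qed

section \<open>Center and lower central series\<close>

lemma subspace_center: "subspace center"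
  by (auto simp: subspace_def center_def mul_add_left mul_scale_left)

lemma centerD:
  assumes "z \<in> center"
  shows "z \<star> x = 0" and "x \<star> z = 0"
  using assms mul_skew[of x z] by (auto simp: center_def)

lemma subspace_lower_central: "subspace (lower_central k)"
  by (induction k rule: lower_central.induct) (auto simp: subspace_mul_def)

lemma lower_central_2: "lower_central 2 = span {u \<star> v | u v. True}"
  by (simp add: numeral_2_eq_2 subspace_mul_def)

lemma lower_central_3: "lower_central 3 = span {a \<star> v | a v. a \<in> lower_central 2}"
  by (simp add: numeral_3_eq_3 numeral_2_eq_2 subspace_mul_def)

lemma mul_in_lower_central_2: "u \<star> v \<in> lower_central 2"
  unfolding lower_central_2 by (auto intro: span_base)

lemma mul_in_lower_central_3: "a \<in> lower_central 2 \<Longrightarrow> a \<star> v \<in> lower_central 3"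
  unfolding lower_central_3 by (auto intro: span_base)

text \<open>As (zu,v) = (uv,z), the element \<open>z\<close> annihilates L exactly when it is
  orthogonal to all products.\<close>

lemma center_iff_perp_lower_central_2:
  "z \<in> center \<longleftrightarrow> (\<forall>a \<in> lower_central 2. form a z = 0)"
proof
  assume z: "z \<in> center"
  have "form (u \<star> v) z = 0" for u v
    using z by (metis centerD(2) form_mul_cyclic form_zero_left)
  then show "\<forall>a \<in> lower_central 2. form a z = 0"
    unfolding lower_central_2
    using perp_span_left[of "{u \<star> v | u v. True}"] by blast
next
  assume "\<forall>a \<in> lower_central 2. form a z = 0"
  then have "form (z \<star> u) v = 0" for u v
    using mul_in_lower_central_2 form_mul_cyclic by metis
  then show "z \<in> center"
    unfolding center_def using form_nondegenerate by blast
qed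

text \<open>L^2 is its own double orthogonal complement: a vector outside L^2 has nonzero pairing
  with some vector orthogonal to L^2, and the latter is central.\<close>

lemma lower_central_2_iff_perp_center:
  "a \<in> lower_central 2 \<longleftrightarrow> (\<forall>z \<in> center. form a z = 0)"
  using separating_vector[OF subspace_lower_central, of a 2] center_iff_perp_lower_central_2
  by fastforce

text \<open>Here (ab,w) = -(aw,b), where \<open>a \<star> w\<close> is central and therefore
  orthogonal to \<open>b\<close>.\<close>

lemma lower_central_2_abelian:
  assumes "lower_central 3 \<subseteq> center" "a \<in> lower_central 2" "b \<in> lower_central 2"
  shows "a \<star> b = 0"
proof (rule form_nondegenerate)
  fix w
  have "a \<star> w \<in> center"
    using assms mul_in_lower_central_3 by blast
  then show "form (a \<star> b) w = 0"
    using assms(3) center_iff_perp_lower_central_2[of "a \<star> w"] form_mul_swap[of a b w]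
      form_skew[of b "a \<star> w"] by simp
qed

section \<open>Image of a degenerate element\<close>

lemma biorthogonal_independent:
  assumes cd: "\<And>i j. i \<in> I \<Longrightarrow> j \<in> I \<Longrightarrow> form (c i) (d j) = (if i = j then 1 else 0)"
  shows "inj_on c I" and "independent (c ` I)"
proof -
  show inj: "inj_on c I"
    using cd by (intro inj_onI) (metis zero_neq_one)
  show "independent (c ` I)"
  proof
    assume "dependent (c ` I)"
    then obtain i where i: "i \<in> I" "c i \<in> span (c ` I - {c i})"
      by (auto simp: dependent_def)
    have "form s (d i) = 0" if "s \<in> c ` I - {c i}" for s
      using that cd i(1) by auto
    then have "form (c i) (d i) = 0"
      using perp_span_left i(2) by blast
    then show False
      using cd i(1) by simp
  qed
qed

lemma center_subset_span:
  assumes "independent S" "S \<subseteq> center" "dim center \<le> card S"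
  shows "center \<subseteq> span S"
proof -
  obtain B where B: "independent B" "span B = UNIV"
    using maximal_independent_subset[of UNIV] by (metis top.extremum_unique)
  interpret finite_dimensional_vector_space scale B
    by unfold_locales (use B finite_independent in auto)
  show ?thesis
    using assms card_ge_dim_independent by blast
qed

text \<open>The radical vector \<open>u\<close> excludes rank \<open>4\<close>: otherwise \<open>z \<star> L\<close> would fill the
  center, and \<open>u\<close>, being orthogonal to \<open>z \<star> L\<close>, would lie in \<open>L\<^sup>2\<close>.\<close>

lemma degenerate_element_image:
  assumes L3: "lower_central 3 \<subseteq> center" and dim: "dim center = 4"
    and z: "z \<in> lower_central 2" "z \<notin> center"
    and u: "u \<notin> lower_central 2" "z \<star> u = 0"
  obtains p q where "form (z \<star> p) q = 1" and "\<And>v. z \<star> v \<in> span {z \<star> p, z \<star> q}"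
proof -
  have zc: "z \<star> v \<in> center" for v
    using mul_in_lower_central_3[OF z(1)] L3 by blast
  have alt: "form (z \<star> v) v = 0" for v
    using form_mul_cyclic[of z v v] by (simp add: mul_alternating)
  obtain p where "z \<star> p \<noteq> 0"
    using z(2) by (auto simp: center_def)
  then obtain q' where q': "form (z \<star> p) q' \<noteq> 0"
    using form_nondegenerate[of "z \<star> p"] by auto
  define q where "q = scale (inverse (form (z \<star> p) q')) q'"
  have pq: "form (z \<star> p) q = 1"
    using q' by (simp add: q_def form_scale_right)
  then have qp: "form (z \<star> q) p = -1"
    using form_mul_swap[of z q p] by simp
  have "z \<star> v \<in> span {z \<star> p, z \<star> q}" for v
  proof (rule ccontr)
    assume v: "z \<star> v \<notin> span {z \<star> p, z \<star> q}"
    \<comment> \<open>Symplectic Gram-Schmidt for the alternating form (u,v) -> (zu,v):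
      \<open>p\<close>, \<open>q\<close> is a hyperbolic pair and \<open>r\<close> is the part of
      \<open>v\<close> orthogonal to it.\<close>
    define r where "r = v - scale (form (z \<star> v) q) p + scale (form (z \<star> v) p) q"
    have zr: "z \<star> r = z \<star> v - scale (form (z \<star> v) q) (z \<star> p) + scale (form (z \<star> v) p) (z \<star> q)"
      by (simp add: r_def mul_linear)
    have rp: "form (z \<star> r) p = 0" "form (z \<star> r) q = 0"
      unfolding zr by (simp_all add: form_linear pq qp alt)
    obtain w where w: "form (z \<star> p) w = 0" "form (z \<star> q) w = 0" "form (z \<star> v) w = 1"
      using separating_vector_finite[OF _ v] by auto
    have rw: "form (z \<star> r) w = 1"
      unfolding zr by (simp add: form_linear w)
    \<comment> \<open>The pairs \<open>p\<close>, \<open>q\<close> and \<open>r\<close>,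
      \<open>w\<close> are hyperbolic and mutually orthogonal. With the signs in \<open>d\<close>
      the four images become biorthogonal to \<open>d\<close>, so they are independent and span the
      center.\<close>
    define c where "c = (\<lambda>i::nat. [z \<star> p, z \<star> q, z \<star> r, z \<star> w] ! i)"
    define d where "d = (\<lambda>i::nat. [q, - p, w, - r] ! i)"
    have pr: "form (z \<star> p) r = 0" "form (z \<star> q) r = 0" "form (z \<star> w) r = -1"
      "form (z \<star> w) p = 0" "form (z \<star> w) q = 0"
      using form_mul_swap[of z p r] form_mul_swap[of z q r] form_mul_swap[of z w r]
        form_mul_swap[of z w p] form_mul_swap[of z w q] rp rw w by simp_all
    have U: "{..<4} = {0, 1, 2, 3::nat}" by auto
    have cd: "form (c i) (d j) = (if i = j then 1 else 0)" if "i < 4" "j < 4" for i j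
    proof -
      have "i \<in> {0,1,2,3}" "j \<in> {0,1,2,3}" using that by auto
      then show ?thesis
        by (auto simp: c_def d_def form_linear pq qp rp rw w pr alt)
    qed
    have c: "inj_on c {..<4}" "independent (c ` {..<4})"
      using cd by (intro biorthogonal_independent[of "{..<4}" c d]; simp)+
    have "c ` {..<4} \<subseteq> center"
      using zc by (auto simp: c_def U)
    then have sp: "center \<subseteq> span (c ` {..<4})"
      using c dim by (intro center_subset_span) (auto simp: card_image)
    have "form (z \<star> v) u = 0" for v
      using form_mul_swap[of z v u] u(2) by simp
    then have cu: "form b u = 0" if "b \<in> c ` {..<4}" for b
      using that by (auto simp: U c_def)
    have "form u a = 0" if "a \<in> center" for a
      using perp_span_left[OF cu] that sp form_skew[of u a] by auto
    then show False
      using u(1) lower_central_2_iff_perp_center by blast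
  qed
  then show thesis using that pq by blast
qed


section \<open>Type A in terms of representatives\<close>

lemma coset_eq_iff:
  assumes "subspace U"
  shows "{v + u | u. u \<in> U} = {w + u | u. u \<in> U} \<longleftrightarrow> v - w \<in> U"
proof
  assume eq: "{v + u | u. u \<in> U} = {w + u | u. u \<in> U}"
  have "v \<in> {v + u | u. u \<in> U}"
    using subspace_0[OF assms] by force
  then show "v - w \<in> U"
    unfolding eq by auto
next
  assume vw: "v - w \<in> U"
  show "{v + u | u. u \<in> U} = {w + u | u. u \<in> U}"
  proof safe
    fix u assume "u \<in> U"
    then show "\<exists>u'. v + u = w + u' \<and> u' \<in> U"
      using subspace_add[OF assms vw] by (intro exI[of _ "v - w + u"]) simp
  next
    fix u assume "u \<in> U"
    then show "\<exists>u'. w + u = v + u' \<and> u' \<in> U"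
      using subspace_diff[OF assms _ vw] by (intro exI[of _ "u - (v - w)"]) simp
  qed
qed

lemma coset_combination:
  assumes "subspace U"
  shows "coset_add (coset_scale U a {z + u | u. u \<in> U}) (coset_scale U b {t + u | u. u \<in> U})
    = {scale a z + scale b t + u | u. u \<in> U}" (is "?L = ?R")
proof
  show "?L \<subseteq> ?R"
  proof
    fix d assume "d \<in> ?L"
    then obtain u1 u2 u3 u4 where u: "u1 \<in> U" "u2 \<in> U" "u3 \<in> U" "u4 \<in> U"
      and d: "d = scale a (z + u1) + u2 + (scale b (t + u3) + u4)"
      unfolding coset_add_def coset_scale_def by blast
    have "d = scale a z + scale b t + (scale a u1 + u2 + (scale b u3 + u4))"
      unfolding d by (simp add: scale_right_distrib algebra_simps)
    moreover have "scale a u1 + u2 + (scale b u3 + u4) \<in> U"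
      using u assms by (simp add: subspace_add subspace_scale)
    ultimately show "d \<in> ?R" by blast
  qed
  show "?R \<subseteq> ?L"
  proof
    fix d assume "d \<in> ?R"
    then obtain u where u: "u \<in> U" and d: "d = (scale a (z + 0) + u) + (scale b (t + 0) + 0)"
      by (auto simp: algebra_simps)
    then show "d \<in> ?L"
      unfolding coset_add_def coset_scale_def using subspace_0[OF assms] by blast
  qed
qed

lemma quotient_basis_pair_coset_iff:
  assumes "subspace U" "z \<in> W" "t \<in> W"
  shows "quotient_basis_pair W U {z + u | u. u \<in> U} {t + u | u. u \<in> U} \<longleftrightarrow>
    (\<forall>w\<in>W. \<exists>!p. w - (scale (fst p) z + scale (snd p) t) \<in> U)"
proof -
  have "{v + u | u. u \<in> U} \<in> quotient_space W U" if "v \<in> W" for v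
    using that by (auto simp: quotient_space_def)
  then show ?thesis
    using assms(2,3) unfolding quotient_basis_pair_def coset_combination[OF assms(1)]
    by (simp add: quotient_space_def coset_eq_iff[OF assms(1)])
qed

text \<open>This evaluates the definite description in \<open>phi\<close>. A change of
  representatives contributes nothing: central elements annihilate L, L^2 is abelian, and
  \<open>z \<star> m\<close> is central, hence orthogonal to L^2.\<close>

lemma phi_coset:
  assumes "lower_central 3 \<subseteq> center" "z \<in> lower_central 2"
  shows "phi {z + c | c. c \<in> center} {m + a | a. a \<in> lower_central 2}
    {n + a | a. a \<in> lower_central 2} = form (z \<star> m) n"
proof -
  have zm: "z \<star> m \<in> center"
    using assms mul_in_lower_central_3 by blast
  have eq: "form ((z + c) \<star> (m + a)) (n + b) = form (z \<star> m) n"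
    if "c \<in> center" "a \<in> lower_central 2" "b \<in> lower_central 2" for a b c
  proof -
    have "form (z \<star> m) b = 0"
      using zm that(3) center_iff_perp_lower_central_2 form_skew[of _ b] by auto
    then show ?thesis
      using that lower_central_2_abelian[OF assms that(2)]
      by (simp add: mul_linear centerD form_linear)
  qed
  \<comment> \<open>The cosets contain their representatives, so no other value is possible.\<close>
  have 0: "0 \<in> center" "0 \<in> lower_central 2"
    using subspace_0 subspace_center subspace_lower_central by blast+
  show ?thesis
    unfolding phi_def
  proof (rule the_equality)
    show "\<forall>z'\<in>{z + c | c. c \<in> center}. \<forall>u\<in>{m + a | a. a \<in> lower_central 2}.
        \<forall>v\<in>{n + a | a. a \<in> lower_central 2}. form (z' \<star> u) v = form (z \<star> m) n"
      using eq by blast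
  next
    fix d
    assume "\<forall>z'\<in>{z + c | c. c \<in> center}. \<forall>u\<in>{m + a | a. a \<in> lower_central 2}.
        \<forall>v\<in>{n + a | a. a \<in> lower_central 2}. form (z' \<star> u) v = d"
    then have "form ((z + 0) \<star> (m + 0)) (n + 0) = d"
      using 0 by blast
    then show "d = form (z \<star> m) n" by simp
  qed
qed

lemma phi_degenerate_coset_iff:
  assumes "lower_central 3 \<subseteq> center" "z \<in> lower_central 2"
  shows "phi_degenerate {z + c | c. c \<in> center} \<longleftrightarrow> (\<exists>m. m \<notin> lower_central 2 \<and> z \<star> m = 0)"
proof -
  have "{m + a | a. a \<in> lower_central 2} = lower_central 2 \<longleftrightarrow> m \<in> lower_central 2" for m
    using coset_eq_iff[OF subspace_lower_central, of m 2 0] by simp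
  moreover have "(\<forall>n. form (z \<star> m) n = 0) \<longleftrightarrow> z \<star> m = 0" for m
    using form_nondegenerate[of "z \<star> m"] by auto
  ultimately show ?thesis
    unfolding phi_degenerate_def quotient_space_def by (simp add: phi_coset[OF assms])
qed

text \<open>Removes the cosets from type A. It serves both to extract \<open>z\<close> and
  \<open>t\<close> from an abstract algebra and to verify type A in the model.\<close>

lemma type_A_iff:
  assumes "lower_central 3 \<subseteq> center"
  shows "type_A \<longleftrightarrow> (\<exists>z\<in>lower_central 2. \<exists>t\<in>lower_central 2.
    (\<forall>w\<in>lower_central 2. \<exists>!p. w - (scale (fst p) z + scale (snd p) t) \<in> center) \<and>
    (\<exists>m. m \<notin> lower_central 2 \<and> z \<star> m = 0) \<and> (\<exists>m. m \<notin> lower_central 2 \<and> t \<star> m = 0))"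
  (is "_ = ?R")
proof
  assume type_A
  then obtain B C where BC: "quotient_basis_pair (lower_central 2) center B C"
    "phi_degenerate B" "phi_degenerate C"
    unfolding type_A_def by blast
  then have "B \<in> quotient_space (lower_central 2) center" "C \<in> quotient_space (lower_central 2) center"
    by (simp_all add: quotient_basis_pair_def)
  then obtain z t where zt: "z \<in> lower_central 2" "t \<in> lower_central 2"
    "B = {z + c | c. c \<in> center}" "C = {t + c | c. c \<in> center}"
    unfolding quotient_space_def by (elim imageE)
  show ?R
    using BC zt(1,2) unfolding zt(3,4) quotient_basis_pair_coset_iff[OF subspace_center zt(1,2)]
      phi_degenerate_coset_iff[OF assms zt(1)] phi_degenerate_coset_iff[OF assms zt(2)]
    by (intro bexI[of _ z] bexI[of _ t] conjI)
next
  assume ?R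
  then obtain z t where zt: "z \<in> lower_central 2" "t \<in> lower_central 2"
    and R: "\<forall>w\<in>lower_central 2. \<exists>!p. w - (scale (fst p) z + scale (snd p) t) \<in> center"
    "\<exists>m. m \<notin> lower_central 2 \<and> z \<star> m = 0" "\<exists>m. m \<notin> lower_central 2 \<and> t \<star> m = 0"
    by (elim bexE conjE)
  show type_A
    unfolding type_A_def
  proof (intro exI conjI)
    show "quotient_basis_pair (lower_central 2) center {z + c | c. c \<in> center} {t + c | c. c \<in> center}"
      using R(1) quotient_basis_pair_coset_iff[OF subspace_center zt] by simp
    show "phi_degenerate {z + c | c. c \<in> center}" "phi_degenerate {t + c | c. c \<in> center}"
      using R(2,3) phi_degenerate_coset_iff[OF assms zt(1)] phi_degenerate_coset_iff[OF assms zt(2)]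
      by simp_all
  qed
qed

end

text \<open>Only data that determine the algebra are recorded: one form value of each skew pair, the
  rows of \<open>x1\<close> and \<open>y1\<close>, centrality of \<open>x2\<close> to
  \<open>x5\<close>, and one value for each of the four triples among \<open>y2\<close> to
  \<open>y5\<close>. The rest of the table follows by the cyclic identity.\<close>

locale P_10_4_2_basis = symplectic_alternating_algebra +
  fixes x1 x2 x3 x4 x5 y1 y2 y3 y4 y5
  assumes span_basis: "span {x1, x2, x3, x4, x5, y1, y2, y3, y4, y5} = UNIV"
    and x2_center: "x2 \<in> center" and x3_center: "x3 \<in> center"
    and x4_center: "x4 \<in> center" and x5_center: "x5 \<in> center"
    and form_x1: "form x1 x2 = 0" "form x1 x3 = 0" "form x1 x4 = 0" "form x1 x5 = 0"
    "form x1 y1 = 1" "form x1 y2 = 0" "form x1 y3 = 0" "form x1 y4 = 0" "form x1 y5 = 0"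
    and form_x2: "form x2 x3 = 0" "form x2 x4 = 0" "form x2 x5 = 0"
    "form x2 y1 = 0" "form x2 y2 = 1" "form x2 y3 = 0" "form x2 y4 = 0" "form x2 y5 = 0"
    and form_x3: "form x3 x4 = 0" "form x3 x5 = 0"
    "form x3 y1 = 0" "form x3 y2 = 0" "form x3 y3 = 1" "form x3 y4 = 0" "form x3 y5 = 0"
    and form_x4: "form x4 x5 = 0"
    "form x4 y1 = 0" "form x4 y2 = 0" "form x4 y3 = 0" "form x4 y4 = 1" "form x4 y5 = 0"
    and form_x5: "form x5 y1 = 0" "form x5 y2 = 0" "form x5 y3 = 0" "form x5 y4 = 0" "form x5 y5 = 1"
    and form_y: "form y1 y2 = 0" "form y1 y3 = 0" "form y1 y4 = 0" "form y1 y5 = 0"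
    "form y2 y3 = 0" "form y2 y4 = 0" "form y2 y5 = 0" "form y3 y4 = 0" "form y3 y5 = 0"
    "form y4 y5 = 0"
    and mul_x1: "x1 \<star> y1 = 0" "x1 \<star> y2 = x3" "x1 \<star> y3 = - x2" "x1 \<star> y4 = 0" "x1 \<star> y5 = 0"
    and mul_y1: "y1 \<star> y2 = 0" "y1 \<star> y3 = 0" "y1 \<star> y4 = x5" "y1 \<star> y5 = - x4"
    and form_mul_y: "form (y2 \<star> y3) y4 = 0" "form (y2 \<star> y3) y5 = 0"
    "form (y4 \<star> y5) y2 = 0" "form (y4 \<star> y5) y3 = 0"

section \<open>Construction of the adapted basis\<close>

context symplectic_alternating_algebra
begin

text \<open>Since (zd,w) = -(zw,d), only the pairings of \<open>d\<close> with the image of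
  \<open>z\<close> matter.\<close>

lemma mul_eq_of_image:
  assumes im: "\<And>v. z \<star> v \<in> span {a, b}" and "form a d = form a e" "form b d = form b e"
  shows "z \<star> d = z \<star> e"
proof (rule form_eqI)
  fix w
  have "form s (d - e) = 0" if "s \<in> {a, b}" for s
    using that assms(2,3) by (auto simp: form_diff_right)
  then have "form (z \<star> w) (d - e) = 0"
    using perp_span_left[of "{a, b}"] im by blast
  then show "form (z \<star> d) w = form (z \<star> e) w"
    using form_mul_swap[of z w d] form_mul_swap[of z w e] by (simp add: form_diff_right)
qed

text \<open>Three vectors cannot span the 4-dimensional center, so \<open>a\<close> is not redundant
  and can be separated from the other three.\<close>

lemma dual_vector:
  assumes "dim center = 4" and "center \<subseteq> span {a, b, c, d}"
  obtains w where "form a w = 1" "form b w = 0" "form c w = 0" "form d w = 0"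
proof -
  have "a \<notin> span {b, c, d}"
  proof
    assume "a \<in> span {b, c, d}"
    then have "center \<subseteq> span {b, c, d}"
      using assms(2) by (simp add: span_redundant)
    then have "dim center \<le> card {b, c, d}"
      by (rule dim_le_card) simp
    then show False
      using assms(1) card_insert_le_m1[of 3 "{c, d}" b] card_insert_le_m1[of 2 "{d}" c] by simp
  qed
  then show thesis
    using separating_vector_finite[of "{b, c, d}" a] that by auto
qed


lemma type_A_adapted_vectors:
  assumes L3: "lower_central 3 = center" and dim: "dim center = 4" and type_A
  obtains z t x2 x3 x4 x5 d2 d3 d4 d5 where
    "z \<in> lower_central 2" "t \<in> lower_central 2" "form z t = 1"
    "\<And>a. a \<in> lower_central 2 \<Longrightarrow> \<exists>\<alpha> \<beta>. a - (scale \<alpha> z + scale \<beta> t) \<in> center"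
    "center = span {x2, x3, x4, x5}"
    "form x2 d2 = 1" "form x2 d3 = 0" "form x2 d4 = 0" "form x2 d5 = 0"
    "form x3 d2 = 0" "form x3 d3 = 1" "form x3 d4 = 0" "form x3 d5 = 0"
    "form x4 d2 = 0" "form x4 d3 = 0" "form x4 d4 = 1" "form x4 d5 = 0"
    "form x5 d2 = 0" "form x5 d3 = 0" "form x5 d4 = 0" "form x5 d5 = 1"
    "z \<star> d2 = x3" "z \<star> d3 = - x2" "z \<star> d4 = 0" "z \<star> d5 = 0"
    "t \<star> d2 = 0" "t \<star> d3 = 0" "t \<star> d4 = x5" "t \<star> d5 = - x4"
proof -
  have L3': "lower_central 3 \<subseteq> center"
    using L3 by simp
  obtain z t' m m' where z: "z \<in> lower_central 2" and t': "t' \<in> lower_central 2"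
    and ex1: "\<And>a. a \<in> lower_central 2 \<Longrightarrow> \<exists>!p. a - (scale (fst p) z + scale (snd p) t') \<in> center"
    and m: "m \<notin> lower_central 2" "z \<star> m = 0" and m': "m' \<notin> lower_central 2" "t' \<star> m' = 0"
    using \<open>type_A\<close> unfolding type_A_iff[OF L3'] by (elim bexE conjE exE) blast
  have ex: "\<exists>\<alpha> \<beta>. a - (scale \<alpha> z + scale \<beta> t') \<in> center" if "a \<in> lower_central 2" for a
    using ex1[OF that] by blast
  have z_notin: "z \<notin> center"
  proof
    assume "z \<in> center"
    \<comment> \<open>If \<open>z\<close> were central, 0 would have both (0,0) and (-1,0) as
      coordinates modulo the center.\<close>
    then have "\<And>p. p = (0, 0) \<or> p = (-1, 0) \<Longrightarrow> 0 - (scale (fst p) z + scale (snd p) t') \<in> center"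
      using subspace_0[OF subspace_center] by auto
    then have "(0, 0) = ((-1, 0) :: 'f \<times> 'f)"
      using ex1[OF subspace_0[OF subspace_lower_central]] by metis
    then show False by simp
  qed
  \<comment> \<open>Otherwise \<open>z\<close> would be orthogonal to itself, to \<open>t'\<close>
    and to the center, hence to all of L^2, and so central.\<close>
  have zt': "form z t' \<noteq> 0"
  proof
    assume 0: "form z t' = 0"
    have "form a z = 0" if "a \<in> lower_central 2" for a
    proof -
      obtain \<alpha> \<beta> where "a - (scale \<alpha> z + scale \<beta> t') \<in> center"
        using ex[OF \<open>a \<in> lower_central 2\<close>] by blast
      then have "form z (a - (scale \<alpha> z + scale \<beta> t')) = 0"
        using z lower_central_2_iff_perp_center by blast
      then show ?thesis
        using 0 form_skew[of a z] by (simp add: form_linear form_alternating)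
    qed
    then show False
      using z_notin center_iff_perp_lower_central_2 by blast
  qed
  define t where "t = scale (inverse (form z t')) t'"
  have zt: "form z t = 1"
    using zt' by (simp add: t_def form_scale_right)
  have t: "t \<in> lower_central 2"
    using t' by (simp add: t_def subspace_scale[OF subspace_lower_central])
  have t_t': "scale \<beta> t' = scale (\<beta> * form z t') t" for \<beta>
    using zt' by (simp add: t_def)
  have ext: "\<exists>\<alpha> \<beta>. a - (scale \<alpha> z + scale \<beta> t) \<in> center" if "a \<in> lower_central 2" for a
    using ex[OF that] unfolding t_t' by blast
  have t_notin: "t \<notin> center"
    using zt z lower_central_2_iff_perp_center by force
  have tm': "t \<star> m' = 0"
    using m' by (simp add: t_def mul_linear)
  obtain p q where pq: "form (z \<star> p) q = 1" and z_im: "\<And>v. z \<star> v \<in> span {z \<star> p, z \<star> q}"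
    using degenerate_element_image[OF L3' dim z z_notin m] by blast
  obtain r s where rs: "form (t \<star> r) s = 1" and t_im: "\<And>v. t \<star> v \<in> span {t \<star> r, t \<star> s}"
    using degenerate_element_image[OF L3' dim t t_notin m'(1) tm'] by blast
  \<comment> \<open>In this order, and up to sign, these become x_2, x_3, x_4, x_5.\<close>
  let ?X = "{z \<star> q, z \<star> p, t \<star> s, t \<star> r}"
  have "z \<star> v \<in> span ?X" "t \<star> v \<in> span ?X" for v
    using z_im[of v] t_im[of v] span_mono[of "{z \<star> p, z \<star> q}" ?X] span_mono[of "{t \<star> r, t \<star> s}" ?X]
    by auto
  have "a \<star> v \<in> span ?X" if a: "a \<in> lower_central 2" for a v
  proof -
    obtain \<alpha> \<beta> where ab: "a - (scale \<alpha> z + scale \<beta> t) \<in> center"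
      using ext[OF a] by blast
    have "a \<star> v = scale \<alpha> (z \<star> v) + scale \<beta> (t \<star> v)"
      using centerD(1)[OF ab, of v] by (simp add: mul_linear)
    then show ?thesis
      using \<open>\<And>v. z \<star> v \<in> span ?X\<close> \<open>\<And>v. t \<star> v \<in> span ?X\<close> by (simp add: span_add span_scale)
  qed
  then have center_span: "center \<subseteq> span ?X"
    unfolding L3[symmetric] lower_central_3 by (intro span_minimal) auto
  have center_span': "center = span ?X"
  proof
    show "span ?X \<subseteq> center"
      using mul_in_lower_central_3 z t L3 by (intro span_minimal subspace_center) auto
  qed (rule center_span)
  have zqp: "form (z \<star> q) p = -1" and tsr: "form (t \<star> s) r = -1"
    using form_mul_swap[of z q p] form_mul_swap[of t s r] pq rs by simp_all
  have alt: "form (u \<star> v) v = 0" for u v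
    using form_mul_cyclic[of u v v] by (simp add: mul_alternating)
  obtain d2' where d2': "form (z \<star> q) d2' = 1" "form (z \<star> p) d2' = 0" "form (t \<star> s) d2' = 0" "form (t \<star> r) d2' = 0"
    using dual_vector[OF dim center_span] by blast
  obtain d3 where d3: "form (z \<star> p) d3 = 1" "form (z \<star> q) d3 = 0" "form (t \<star> s) d3 = 0" "form (t \<star> r) d3 = 0"
    using dual_vector[OF dim, of "z \<star> p" "z \<star> q" "t \<star> s" "t \<star> r"] center_span
    by (auto simp: insert_commute)
  obtain d4' where d4': "form (t \<star> s) d4' = 1" "form (z \<star> q) d4' = 0" "form (z \<star> p) d4' = 0" "form (t \<star> r) d4' = 0"
    using dual_vector[OF dim, of "t \<star> s" "z \<star> q" "z \<star> p" "t \<star> r"] center_span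
    by (auto simp: insert_commute)
  obtain d5 where d5: "form (t \<star> r) d5 = 1" "form (z \<star> q) d5 = 0" "form (z \<star> p) d5 = 0" "form (t \<star> s) d5 = 0"
    using dual_vector[OF dim, of "t \<star> r" "z \<star> q" "z \<star> p" "t \<star> s"] center_span
    by (auto simp: insert_commute)
  \<comment> \<open>On the image of \<open>z\<close>, the vector \<open>- d2'\<close> has the same
    pairings as \<open>p\<close>, \<open>d3\<close> the same as \<open>q\<close>, and
    \<open>- d4'\<close>, \<open>d5\<close> the same as 0; for \<open>t\<close> the roles are
    exchanged, with \<open>r\<close> and \<open>s\<close>.\<close>
  have zd: "z \<star> (- d2') = z \<star> p" "z \<star> d3 = z \<star> q" "z \<star> (- d4') = z \<star> 0" "z \<star> d5 = z \<star> 0"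
    by (rule mul_eq_of_image[OF z_im]; simp add: form_linear d2' d3 d4' d5 pq zqp alt)+
  have td: "t \<star> (- d2') = t \<star> 0" "t \<star> d3 = t \<star> 0" "t \<star> (- d4') = t \<star> r" "t \<star> d5 = t \<star> s"
    by (rule mul_eq_of_image[OF t_im]; simp add: form_linear d2' d3 d4' d5 rs tsr alt)+
  have span_eq: "center = span {- (z \<star> q), z \<star> p, - (t \<star> s), t \<star> r}"
  proof (unfold center_span', rule antisym)
    let ?Y = "{- (z \<star> q), z \<star> p, - (t \<star> s), t \<star> r}"
    have "x \<in> span ?Y" if "- x \<in> ?Y" for x
      using span_neg[OF span_base[OF that]] by simp
    then have "?X \<subseteq> span ?Y"
      by (auto intro: span_base)
    then show "span ?X \<subseteq> span ?Y"
      by (rule span_minimal) simp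
    have "?Y \<subseteq> span ?X"
      by (auto intro!: span_neg intro: span_base)
    then show "span ?Y \<subseteq> span ?X"
      by (rule span_minimal) simp
  qed
  show thesis
    by (rule that[OF z t zt ext span_eq, of "- d2'" d3 "- d4'" d5])
      (simp_all add: zd td form_linear d2' d3 d4' d5)
qed


lemma type_A_basis:
  assumes L3: "lower_central 3 = center" and dim: "dim center = 4" and type_A
    and iso: "isotropic center"
  shows "\<exists>x1 x2 x3 x4 x5 y1 y2 y3 y4 y5.
    P_10_4_2_basis scale form mul x1 x2 x3 x4 x5 y1 y2 y3 y4 y5"
proof -
  obtain z t x2 x3 x4 x5 d2 d3 d4 d5 where z: "z \<in> lower_central 2"
    and t: "t \<in> lower_central 2" and zt: "form z t = 1"
    and ex: "\<And>a. a \<in> lower_central 2 \<Longrightarrow> \<exists>\<alpha> \<beta>. a - (scale \<alpha> z + scale \<beta> t) \<in> center"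
    and center_span: "center = span {x2, x3, x4, x5}"
    and xd: "form x2 d2 = 1" "form x2 d3 = 0" "form x2 d4 = 0" "form x2 d5 = 0"
    "form x3 d2 = 0" "form x3 d3 = 1" "form x3 d4 = 0" "form x3 d5 = 0"
    "form x4 d2 = 0" "form x4 d3 = 0" "form x4 d4 = 1" "form x4 d5 = 0"
    "form x5 d2 = 0" "form x5 d3 = 0" "form x5 d4 = 0" "form x5 d5 = 1"
    and zd: "z \<star> d2 = x3" "z \<star> d3 = - x2" "z \<star> d4 = 0" "z \<star> d5 = 0"
    and td: "t \<star> d2 = 0" "t \<star> d3 = 0" "t \<star> d4 = x5" "t \<star> d5 = - x4"
    by (rule type_A_adapted_vectors[OF L3 dim \<open>type_A\<close>], rule that)
  have x_center: "x2 \<in> center" "x3 \<in> center" "x4 \<in> center" "x5 \<in> center"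
    unfolding center_span by (simp_all add: span_base)
  have ztm: "z \<star> t = 0" "t \<star> z = 0" "z \<star> z = 0" "t \<star> t = 0"
    using lower_central_2_abelian L3 z t by simp_all
  have dz: "d2 \<star> z = - x3" "d3 \<star> z = x2" "d4 \<star> z = 0" "d5 \<star> z = 0"
    and dt: "d2 \<star> t = 0" "d3 \<star> t = 0" "d4 \<star> t = - x5" "d5 \<star> t = x4"
    using mul_skew[of d2 z] mul_skew[of d3 z] mul_skew[of d4 z] mul_skew[of d5 z]
      mul_skew[of d2 t] mul_skew[of d3 t] mul_skew[of d4 t] mul_skew[of d5 t]
    by (simp_all only: zd td minus_minus minus_zero)
  have x_perp: "form c a = 0" "form a c = 0" if "c \<in> center" "a \<in> lower_central 2" for a c
    using lower_central_2_iff_perp_center[of a] form_skew[of c a] that by simp_all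
  have xz: "form x2 z = 0" "form x3 z = 0" "form x4 z = 0" "form x5 z = 0"
    "form x2 t = 0" "form x3 t = 0" "form x4 t = 0" "form x5 t = 0"
    "form z x2 = 0" "form z x3 = 0" "form z x4 = 0" "form z x5 = 0"
    "form t x2 = 0" "form t x3 = 0" "form t x4 = 0" "form t x5 = 0"
    using x_perp x_center z t by blast+
  have xx: "form a b = 0" if "a \<in> {x2, x3, x4, x5}" "b \<in> {x2, x3, x4, x5}" for a b
    using that iso x_center by (auto simp: isotropic_def)
  have dx: "form d2 x2 = -1" "form d3 x2 = 0" "form d4 x2 = 0" "form d5 x2 = 0"
    "form d2 x3 = 0" "form d3 x3 = -1" "form d4 x3 = 0" "form d5 x3 = 0"
    "form d2 x4 = 0" "form d3 x4 = 0" "form d4 x4 = -1" "form d5 x4 = 0"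
    "form d2 x5 = 0" "form d3 x5 = 0" "form d4 x5 = 0" "form d5 x5 = -1"
    by (rule form_eq_swap, simp add: xd)+
  \<comment> \<open>Since (d_2d_3,z) = (zd_2,d_3) = 1 and likewise (d_4d_5,t) = 1, each coefficient
    cancels one triple value. The products d_2d_3 and d_4d_5 survive unchanged, as \<open>t\<close>
    annihilates d_2, d_3 and \<open>z\<close> annihilates d_4, d_5.\<close>
  define e2 where "e2 = d2 - scale (form (d4 \<star> d5) d2) t"
  define e3 where "e3 = d3 - scale (form (d4 \<star> d5) d3) t"
  define e4 where "e4 = d4 - scale (form (d2 \<star> d3) d4) z"
  define e5 where "e5 = d5 - scale (form (d2 \<star> d3) d5) z"
  have e23: "e2 \<star> e3 = d2 \<star> d3" and e45: "e4 \<star> e5 = d4 \<star> d5"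
    by (simp_all add: e2_def e3_def e4_def e5_def mul_linear zd td dz dt ztm)
  have "form (d2 \<star> d3) z = 1" "form (d4 \<star> d5) t = 1"
    using form_mul_cyclic[of z d2 d3] form_mul_cyclic[of t d4 d5] zd td xd by simp_all
  then have Te: "form (e2 \<star> e3) e4 = 0" "form (e2 \<star> e3) e5 = 0"
    "form (e4 \<star> e5) e2 = 0" "form (e4 \<star> e5) e3 = 0"
    unfolding e23 e45 by (simp_all add: e2_def e3_def e4_def e5_def form_linear)
  have xe: "form x2 e2 = 1" "form x2 e3 = 0" "form x2 e4 = 0" "form x2 e5 = 0"
    "form x3 e2 = 0" "form x3 e3 = 1" "form x3 e4 = 0" "form x3 e5 = 0"
    "form x4 e2 = 0" "form x4 e3 = 0" "form x4 e4 = 1" "form x4 e5 = 0"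
    "form x5 e2 = 0" "form x5 e3 = 0" "form x5 e4 = 0" "form x5 e5 = 1"
    "form e2 x2 = -1" "form e3 x2 = 0" "form e4 x2 = 0" "form e5 x2 = 0"
    "form e2 x3 = 0" "form e3 x3 = -1" "form e4 x3 = 0" "form e5 x3 = 0"
    "form e2 x4 = 0" "form e3 x4 = 0" "form e4 x4 = -1" "form e5 x4 = 0"
    "form e2 x5 = 0" "form e3 x5 = 0" "form e4 x5 = 0" "form e5 x5 = -1"
    by (simp_all add: e2_def e3_def e4_def e5_def form_linear xd dx xz)
  have ze: "z \<star> e2 = x3" "z \<star> e3 = - x2" "z \<star> e4 = 0" "z \<star> e5 = 0"
    "t \<star> e2 = 0" "t \<star> e3 = 0" "t \<star> e4 = x5" "t \<star> e5 = - x4"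
    by (simp_all add: e2_def e3_def e4_def e5_def mul_linear zd td ztm)
  \<comment> \<open>As the x_i are dual to the e_j, these central corrections make \<open>x1\<close>
    and \<open>y1\<close> orthogonal to every e_j.\<close>
  define x1 where "x1 = z - (scale (form z e2) x2 + scale (form z e3) x3
    + scale (form z e4) x4 + scale (form z e5) x5)"
  define y1 where "y1 = t - (scale (form t e2) x2 + scale (form t e3) x3
    + scale (form t e4) x4 + scale (form t e5) x5)"
  \<comment> \<open>Each value (e_i,e_j) with i < j is cancelled by a multiple of x_i added to e_j
    alone. Correcting only one vector of each pair avoids halving, so characteristic 2 is
    covered.\<close>
  define y2 where "y2 = e2"
  define y3 where "y3 = e3 + scale (form e2 e3) x2"
  define y4 where "y4 = e4 + scale (form e2 e4) x2 + scale (form e3 e4) x3"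
  define y5 where "y5 = e5 + scale (form e2 e5) x2 + scale (form e3 e5) x3 + scale (form e4 e5) x4"
  note y_defs = x1_def y1_def y2_def y3_def y4_def y5_def
  have center_mul: "c \<star> v = 0" "v \<star> c = 0" if "c \<in> {x2, x3, x4, x5}" for c v
    using that x_center centerD by blast+
  have y23: "y2 \<star> y3 = e2 \<star> e3" and y45: "y4 \<star> y5 = e4 \<star> e5"
    by (simp_all add: y_defs mul_linear center_mul)
  have prod_perp: "form (u \<star> v) c = 0" if "c \<in> {x2, x3, x4, x5}" for u v c
    using that x_perp(2) mul_in_lower_central_2 x_center by blast
  have xy: "form x2 y2 = 1" "form x2 y3 = 0" "form x2 y4 = 0" "form x2 y5 = 0"
    "form x3 y2 = 0" "form x3 y3 = 1" "form x3 y4 = 0" "form x3 y5 = 0"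
    "form x4 y2 = 0" "form x4 y3 = 0" "form x4 y4 = 1" "form x4 y5 = 0"
    "form x5 y2 = 0" "form x5 y3 = 0" "form x5 y4 = 0" "form x5 y5 = 1"
    by (simp_all add: y_defs form_linear xe xx)
  let ?S = "{x1, x2, x3, x4, x5, y1, y2, y3, y4, y5}"
  have "v \<in> span ?S" for v
  proof -
    \<comment> \<open>Removing the components along \<open>y2\<close> to \<open>y5\<close> leaves a
      vector orthogonal to the center, hence in L^2, where \<open>z\<close>, \<open>t\<close> and
      the center suffice.\<close>
    define v' where "v' = v - (scale (form x2 v) y2 + scale (form x3 v) y3
      + scale (form x4 v) y4 + scale (form x5 v) y5)"
    have "form s v' = 0" if "s \<in> {x2, x3, x4, x5}" for s
      using that by (auto simp: v'_def form_linear xy)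
    then have "form v' c = 0" if "c \<in> center" for c
      using that perp_span_left[of "{x2, x3, x4, x5}" v' c] form_eq_swap[of c v' 0]
      unfolding center_span by simp
    then have "v' \<in> lower_central 2"
      using lower_central_2_iff_perp_center by blast
    then obtain \<alpha> \<beta> where ab: "v' - (scale \<alpha> z + scale \<beta> t) \<in> center"
      using ex by blast
    have center_S: "center \<subseteq> span ?S"
      unfolding center_span by (rule span_mono) auto
    have S: "x1 \<in> span ?S" "y1 \<in> span ?S" "y2 \<in> span ?S" "y3 \<in> span ?S" "y4 \<in> span ?S"
      "y5 \<in> span ?S" "x2 \<in> span ?S" "x3 \<in> span ?S" "x4 \<in> span ?S" "x5 \<in> span ?S"
      by (simp_all add: span_base)
    have "z = x1 + (scale (form z e2) x2 + scale (form z e3) x3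
        + scale (form z e4) x4 + scale (form z e5) x5)"
      "t = y1 + (scale (form t e2) x2 + scale (form t e3) x3
        + scale (form t e4) x4 + scale (form t e5) x5)"
      by (simp_all add: y_defs)
    then have "z \<in> span ?S" "t \<in> span ?S"
      using S by (metis span_add span_scale)+
    then have "scale \<alpha> z + scale \<beta> t \<in> span ?S"
      by (intro span_add span_scale)
    moreover have "v = (v' - (scale \<alpha> z + scale \<beta> t)) + ((scale \<alpha> z + scale \<beta> t) +
      (scale (form x2 v) y2 + scale (form x3 v) y3 + scale (form x4 v) y4 + scale (form x5 v) y5))"
      by (simp add: v'_def)
    moreover have "v' - (scale \<alpha> z + scale \<beta> t) \<in> span ?S"
      using ab center_S by blast
    moreover have "scale (form x2 v) y2 + scale (form x3 v) y3 + scale (form x4 v) y4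
      + scale (form x5 v) y5 \<in> span ?S"
      using S by (intro span_add span_scale)
    ultimately show ?thesis
      by (metis span_add)
  qed
  then have span_S: "span ?S = UNIV"
    by auto
  have xmul: "x1 \<star> y1 = 0" "x1 \<star> y2 = x3" "x1 \<star> y3 = - x2" "x1 \<star> y4 = 0" "x1 \<star> y5 = 0"
    "y1 \<star> y2 = 0" "y1 \<star> y3 = 0" "y1 \<star> y4 = x5" "y1 \<star> y5 = - x4"
    by (simp_all add: y_defs mul_linear center_mul ze ztm)
  have Ty: "form (y2 \<star> y3) y4 = 0" "form (y2 \<star> y3) y5 = 0"
    "form (y4 \<star> y5) y2 = 0" "form (y4 \<star> y5) y3 = 0"
    unfolding y23 y45 by (simp_all add: y_defs form_linear Te prod_perp)
  have x1_form: "form x1 x2 = 0" "form x1 x3 = 0" "form x1 x4 = 0" "form x1 x5 = 0"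
    "form x1 y1 = 1" "form x1 y2 = 0" "form x1 y3 = 0" "form x1 y4 = 0" "form x1 y5 = 0"
    by (simp_all add: y_defs form_linear xe xx xz zt)
  have y_form: "form x2 y1 = 0" "form x3 y1 = 0" "form x4 y1 = 0" "form x5 y1 = 0"
    "form y1 y2 = 0" "form y1 y3 = 0" "form y1 y4 = 0" "form y1 y5 = 0"
    "form y2 y3 = 0" "form y2 y4 = 0" "form y2 y5 = 0" "form y3 y4 = 0" "form y3 y5 = 0"
    "form y4 y5 = 0"
    by (simp_all add: y_defs form_linear xe xx xz)
  have "P_10_4_2_basis scale form mul x1 x2 x3 x4 x5 y1 y2 y3 y4 y5"
    by unfold_locales (simp_all only: x_center xy span_S xmul Ty x1_form y_form xx insert_iff simp_thms)
  then show ?thesis by blast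
qed

end

section \<open>The coordinate algebra on F^10\<close>

lemma UNIV_10: "(UNIV :: 10 set) = {0, 1, 2, 3, 4, 5, 6, 7, 8, 9}"
proof -
  have "card {0, 1, 2, 3, 4, 5, 6, 7, 8, 9 :: 10} = CARD(10)"
    by simp
  then show ?thesis
    by (intro card_subset_eq[symmetric]) simp_all
qed

lemma forall_10: "(\<forall>i::10. P i) \<longleftrightarrow> P 0 \<and> P 1 \<and> P 2 \<and> P 3 \<and> P 4 \<and> P 5 \<and> P 6 \<and> P 7 \<and> P 8 \<and> P 9"
proof -
  have "(\<forall>i::10. P i) \<longleftrightarrow> (\<forall>i\<in>{0, 1, 2, 3, 4, 5, 6, 7, 8, 9}. P i)"
    using UNIV_10 by auto
  then show ?thesis by simp
qed

text \<open>The last branch is index 9, because the type \<open>10\<close> has exactly the elements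
  0 to 9.\<close>

definition vec10 :: "'a \<Rightarrow> 'a \<Rightarrow> 'a \<Rightarrow> 'a \<Rightarrow> 'a \<Rightarrow> 'a \<Rightarrow> 'a \<Rightarrow> 'a \<Rightarrow> 'a \<Rightarrow> 'a \<Rightarrow> 'a ^ 10" where
  "vec10 a0 a1 a2 a3 a4 a5 a6 a7 a8 a9 = (\<chi> i. if i = 0 then a0 else if i = 1 then a1
    else if i = 2 then a2 else if i = 3 then a3 else if i = 4 then a4 else if i = 5 then a5
    else if i = 6 then a6 else if i = 7 then a7 else if i = 8 then a8 else a9)"

lemma vec10_nth [simp]:
  "vec10 a0 a1 a2 a3 a4 a5 a6 a7 a8 a9 $ 0 = a0" "vec10 a0 a1 a2 a3 a4 a5 a6 a7 a8 a9 $ 1 = a1"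
  "vec10 a0 a1 a2 a3 a4 a5 a6 a7 a8 a9 $ 2 = a2" "vec10 a0 a1 a2 a3 a4 a5 a6 a7 a8 a9 $ 3 = a3"
  "vec10 a0 a1 a2 a3 a4 a5 a6 a7 a8 a9 $ 4 = a4" "vec10 a0 a1 a2 a3 a4 a5 a6 a7 a8 a9 $ 5 = a5"
  "vec10 a0 a1 a2 a3 a4 a5 a6 a7 a8 a9 $ 6 = a6" "vec10 a0 a1 a2 a3 a4 a5 a6 a7 a8 a9 $ 7 = a7"
  "vec10 a0 a1 a2 a3 a4 a5 a6 a7 a8 a9 $ 8 = a8" "vec10 a0 a1 a2 a3 a4 a5 a6 a7 a8 a9 $ 9 = a9"
  by (simp_all add: vec10_def)

lemma vec10_eq_iff:
  fixes u v :: "'a ^ 10"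
  shows "u = v \<longleftrightarrow> u $ 0 = v $ 0 \<and> u $ 1 = v $ 1 \<and> u $ 2 = v $ 2 \<and> u $ 3 = v $ 3 \<and> u $ 4 = v $ 4
    \<and> u $ 5 = v $ 5 \<and> u $ 6 = v $ 6 \<and> u $ 7 = v $ 7 \<and> u $ 8 = v $ 8 \<and> u $ 9 = v $ 9"
  by (simp add: vec_eq_iff forall_10)

text \<open>Coordinates \<open>0, \<dots>, 4\<close> belong to \<open>x\<^sub>1, \<dots>, x\<^sub>5\<close> and coordinates \<open>5, \<dots>, 9\<close> to
  \<open>y\<^sub>1, \<dots>, y\<^sub>5\<close>.\<close>

definition P_form :: "'f::field ^ 10 \<Rightarrow> 'f ^ 10 \<Rightarrow> 'f" where
  "P_form u v = u $ 0 * v $ 5 - u $ 5 * v $ 0 + (u $ 1 * v $ 6 - u $ 6 * v $ 1)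
    + (u $ 2 * v $ 7 - u $ 7 * v $ 2) + (u $ 3 * v $ 8 - u $ 8 * v $ 3)
    + (u $ 4 * v $ 9 - u $ 9 * v $ 4)"

text \<open>The coefficients of \<open>uv\<close> at \<open>x\<^sub>i\<close> and \<open>y\<^sub>i\<close> are \<open>(uv, y\<^sub>i)\<close> and \<open>-(uv, x\<^sub>i)\<close>.\<close>

definition P_mul :: "'f::field ^ 10 \<Rightarrow> 'f ^ 10 \<Rightarrow> 'f ^ 10" where
  "P_mul u v = vec10 (u $ 8 * v $ 9 - u $ 9 * v $ 8) (u $ 7 * v $ 0 - u $ 0 * v $ 7)
    (u $ 0 * v $ 6 - u $ 6 * v $ 0) (u $ 9 * v $ 5 - u $ 5 * v $ 9) (u $ 5 * v $ 8 - u $ 8 * v $ 5)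
    (u $ 7 * v $ 6 - u $ 6 * v $ 7) 0 0 0 0"

lemma P_form_vec10:
  "P_form u (vec10 a0 a1 a2 a3 a4 a5 a6 a7 a8 a9) = u $ 0 * a5 - u $ 5 * a0 + (u $ 1 * a6 - u $ 6 * a1)
    + (u $ 2 * a7 - u $ 7 * a2) + (u $ 3 * a8 - u $ 8 * a3) + (u $ 4 * a9 - u $ 9 * a4)"
  by (simp add: P_form_def)

interpretation P: symplectic_alternating_algebra "(*s) :: 'f::field \<Rightarrow> 'f ^ 10 \<Rightarrow> 'f ^ 10" P_form P_mul
proof unfold_locales
  show "\<exists>B :: ('f ^ 10) set. finite B \<and> vec.span B = UNIV"
    using vec.finite_Basis vec.span_Basis by blast
next
  fix u :: "'f ^ 10"
  assume *: "P_form u v = 0" for v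
  have "u $ 0 = 0" "u $ 1 = 0" "u $ 2 = 0" "u $ 3 = 0" "u $ 4 = 0"
    "u $ 5 = 0" "u $ 6 = 0" "u $ 7 = 0" "u $ 8 = 0" "u $ 9 = 0"
    using *[of "vec10 0 0 0 0 0 1 0 0 0 0"] *[of "vec10 0 0 0 0 0 0 1 0 0 0"]
      *[of "vec10 0 0 0 0 0 0 0 1 0 0"] *[of "vec10 0 0 0 0 0 0 0 0 1 0"]
      *[of "vec10 0 0 0 0 0 0 0 0 0 1"] *[of "vec10 1 0 0 0 0 0 0 0 0 0"]
      *[of "vec10 0 1 0 0 0 0 0 0 0 0"] *[of "vec10 0 0 1 0 0 0 0 0 0 0"]
      *[of "vec10 0 0 0 1 0 0 0 0 0 0"] *[of "vec10 0 0 0 0 1 0 0 0 0 0"]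
    by (simp_all add: P_form_vec10)
  then show "u = 0"
    by (simp add: vec10_eq_iff)
next
  fix u v w :: "'f ^ 10"
  show "P_form (P_mul u v) w = P_form (P_mul v w) u"
    by (simp add: P_form_def P_mul_def algebra_simps)
qed (simp_all add: P_form_def P_mul_def vec10_eq_iff algebra_simps)

lemma P_center: "P.center = {u :: 'f::field ^ 10. u $ 0 = 0 \<and> u $ 5 = 0 \<and> u $ 6 = 0 \<and> u $ 7 = 0 \<and> u $ 8 = 0 \<and> u $ 9 = 0}"
proof
  show "P.center \<subseteq> {u :: 'f ^ 10. u $ 0 = 0 \<and> u $ 5 = 0 \<and> u $ 6 = 0 \<and> u $ 7 = 0 \<and> u $ 8 = 0 \<and> u $ 9 = 0}"
  proof
    fix u :: "'f ^ 10" assume "u \<in> P.center"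
    then have *: "P_mul u v = 0" for v
      by (simp add: P.center_def)
    show "u \<in> {u. u $ 0 = 0 \<and> u $ 5 = 0 \<and> u $ 6 = 0 \<and> u $ 7 = 0 \<and> u $ 8 = 0 \<and> u $ 9 = 0}"
      \<comment> \<open>These unit vectors are y_2 to y_5; the products with them already show all
        six coordinates, up to sign.\<close>
      using *[of "vec10 0 0 0 0 0 0 1 0 0 0"] *[of "vec10 0 0 0 0 0 0 0 1 0 0"]
        *[of "vec10 0 0 0 0 0 0 0 0 1 0"] *[of "vec10 0 0 0 0 0 0 0 0 0 1"]
      by (simp add: P_mul_def vec10_eq_iff)
  qed
qed (auto simp: P.center_def P_mul_def vec10_eq_iff)

text \<open>Orthogonality to the center decides membership, so no spanning set of products has to be
  exhibited.\<close>

lemma P_lower_central_2: "P.lower_central 2 = {u :: 'f::field ^ 10. u $ 6 = 0 \<and> u $ 7 = 0 \<and> u $ 8 = 0 \<and> u $ 9 = 0}"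
proof (intro set_eqI iffI)
  fix u :: "'f ^ 10" assume "u \<in> P.lower_central 2"
  then have *: "P_form u c = 0" if "c \<in> P.center" for c
    using that P.lower_central_2_iff_perp_center by blast
  show "u \<in> {u. u $ 6 = 0 \<and> u $ 7 = 0 \<and> u $ 8 = 0 \<and> u $ 9 = 0}"
    using *[of "vec10 0 1 0 0 0 0 0 0 0 0"] *[of "vec10 0 0 1 0 0 0 0 0 0 0"]
      *[of "vec10 0 0 0 1 0 0 0 0 0 0"] *[of "vec10 0 0 0 0 1 0 0 0 0 0"]
    by (simp add: P_center P_form_vec10)
next
  fix u :: "'f ^ 10" assume "u \<in> {u. u $ 6 = 0 \<and> u $ 7 = 0 \<and> u $ 8 = 0 \<and> u $ 9 = 0}"
  then show "u \<in> P.lower_central 2"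
    by (simp add: P.lower_central_2_iff_perp_center P_center P_form_def)
qed

lemma P_lower_central_3: "P.lower_central 3 = (P.center :: ('f::field ^ 10) set)"
proof
  show "P.lower_central 3 \<subseteq> (P.center :: ('f ^ 10) set)"
    unfolding P.lower_central_3
    by (intro vec.span_minimal P.subspace_center) (auto simp: P_lower_central_2 P_center P_mul_def)
  show "(P.center :: ('f ^ 10) set) \<subseteq> P.lower_central 3"
  proof
    fix c :: "'f ^ 10" assume c: "c \<in> P.center"
    \<comment> \<open>Read off from x_1y_2 = x_3, x_1y_3 = -x_2, y_1y_4 = x_5, y_1y_5 = -x_4. One
      vector serves both products, as x_1 annihilates y_4, y_5 and y_1 annihilates y_2, y_3.\<close>
    let ?v = "vec10 0 0 0 0 0 0 (c $ 2) (- c $ 1) (c $ 4) (- c $ 3)"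
    let ?x = "vec10 1 0 0 0 0 0 0 0 0 0" and ?y = "vec10 0 0 0 0 0 1 0 0 0 0"
    have "c = P_mul ?x ?v + P_mul ?y ?v"
      using c by (simp add: P_center P_mul_def vec10_eq_iff)
    moreover have "P_mul ?x ?v \<in> P.lower_central 3" "P_mul ?y ?v \<in> P.lower_central 3"
      by (rule P.mul_in_lower_central_3, simp add: P_lower_central_2)+
    ultimately show "c \<in> P.lower_central 3"
      using vec.subspace_add[OF P.subspace_lower_central] by metis
  qed
qed

lemma P_dim_center: "vec.dim (P.center :: ('f::field ^ 10) set) = 4"
proof -
  let ?I = "{1, 2, 3, 4 :: 10}" and ?c = "\<lambda>i::10. axis i (1 :: 'f)"
  have c: "inj_on ?c ?I" "vec.independent (?c ` ?I)"
    \<comment> \<open>The dual partner y_i of x_i sits five coordinates further on.\<close>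
    by (rule P.biorthogonal_independent[of ?I ?c "\<lambda>i. axis (i + 5) 1"];
        auto simp: P_form_def axis_def)+
  have "u \<in> vec.span (?c ` ?I)" if "u \<in> P.center" for u
  proof -
    have "u = u $ 1 *s ?c 1 + u $ 2 *s ?c 2 + u $ 3 *s ?c 3 + u $ 4 *s ?c 4"
      using that by (simp add: P_center vec10_eq_iff axis_def)
    moreover have "u $ 1 *s ?c 1 + u $ 2 *s ?c 2 + u $ 3 *s ?c 3 + u $ 4 *s ?c 4
      \<in> vec.span (?c ` ?I)"
      by (intro vec.span_add vec.span_scale vec.span_base) auto
    ultimately show ?thesis by metis
  qed
  then show ?thesis
    using c by (intro vec.dim_unique[of "?c ` ?I"])
      (auto simp: P_center axis_def card_image simp del: image_insert)
qed

lemma P_nilpotent_saa_10_4_type_A: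
  "nilpotent_saa_10_4_type_A ((*s) :: 'f::field \<Rightarrow> 'f ^ 10 \<Rightarrow> 'f ^ 10) P_form P_mul"
proof unfold_locales
  show "vec.dim (UNIV :: ('f ^ 10) set) = 10"
    by (simp add: vec.dim_UNIV card_cart_basis)
next
  have "P.lower_central 4 = P.subspace_mul (P.lower_central 3 :: ('f ^ 10) set) UNIV"
    by (simp add: eval_nat_numeral)
  also have "\<dots> = P.subspace_mul P.center UNIV"
    by (simp only: P_lower_central_3)
  also have "\<dots> \<subseteq> {0}"
    unfolding P.subspace_mul_def by (intro vec.span_minimal) (auto simp: P.centerD)
  finally have "P.lower_central 4 \<subseteq> {0 :: 'f ^ 10}" .
  then have "P.lower_central (3 + 1) = {0 :: 'f ^ 10}"
    using vec.subspace_0[OF P.subspace_lower_central[of 4]] by auto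
  then show "symplectic_alternating_algebra.nilpotent ((*s) :: 'f \<Rightarrow> 'f ^ 10 \<Rightarrow> 'f ^ 10) P_mul"
    unfolding P.nilpotent_def by (intro exI[of _ 3]) simp
next
  show "P.isotropic (P.center :: ('f ^ 10) set)"
    by (simp add: P.isotropic_def P_center P_form_def)
  show "vec.dim (P.center :: ('f ^ 10) set) = 4"
    by (rule P_dim_center)
  show "P.lower_central 3 = (P.center :: ('f ^ 10) set)"
    by (rule P_lower_central_3)
next
  \<comment> \<open>These are x_1 and y_1. The radical vectors used below are y_4, annihilated by
    x_1, and y_2, annihilated by y_1.\<close>
  let ?z = "vec10 1 0 0 0 0 0 0 0 0 0 :: 'f ^ 10" and ?t = "vec10 0 0 0 0 0 1 0 0 0 0 :: 'f ^ 10"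
  have "\<exists>!p. w - (fst p *s ?z + snd p *s ?t) \<in> P.center" if "w \<in> P.lower_central 2" for w
  proof (rule ex1I[of _ "(w $ 0, w $ 5)"])
    show "w - (fst (w $ 0, w $ 5) *s ?z + snd (w $ 0, w $ 5) *s ?t) \<in> P.center"
      using that by (simp add: P_center P_lower_central_2)
    show "p = (w $ 0, w $ 5)" if "w - (fst p *s ?z + snd p *s ?t) \<in> P.center" for p
      using that by (cases p) (simp add: P_center)
  qed
  moreover have "\<exists>m. m \<notin> P.lower_central 2 \<and> P_mul ?z m = 0"
    by (intro exI[of _ "vec10 0 0 0 0 0 0 0 0 1 0"])
      (simp add: P_lower_central_2 P_mul_def vec10_eq_iff)
  moreover have "\<exists>m. m \<notin> P.lower_central 2 \<and> P_mul ?t m = 0"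
    by (intro exI[of _ "vec10 0 0 0 0 0 0 1 0 0 0"])
      (simp add: P_lower_central_2 P_mul_def vec10_eq_iff)
  moreover have "?z \<in> P.lower_central 2" "?t \<in> P.lower_central 2"
    by (simp_all add: P_lower_central_2)
  ultimately show "symplectic_alternating_algebra.type_A ((*s) :: 'f \<Rightarrow> 'f ^ 10 \<Rightarrow> 'f ^ 10) P_form P_mul"
    unfolding P.type_A_iff[OF P_lower_central_3[THEN equalityD1]]
    by (intro bexI[of _ ?z] bexI[of _ ?t] conjI ballI)
qed

text \<open>Labels start at 1 and coordinates at 0, whence the shifts by -1 and +4.\<close>

lemma P_standard_basis:
  "P.standard_basis 5 (\<lambda>i. axis (of_nat i - 1) 1) (\<lambda>i. axis (of_nat i + 4) (1 :: 'f::field))"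
proof -
  let ?x = "\<lambda>i. axis (of_nat i - 1 :: 10) (1 :: 'f)" and ?y = "\<lambda>i. axis (of_nat i + 4 :: 10) (1 :: 'f)"
  have I: "{1..5} = {1, 2, 3, 4, 5 :: nat}" by auto
  have "cart_basis = (\<lambda>i. axis i 1) ` (UNIV :: 10 set)"
    by (auto simp: cart_basis_def)
  also have "\<dots> = ?x ` {1..5} \<union> ?y ` {1..5}"
    unfolding UNIV_10 I by (simp add: insert_commute)
  finally have basis: "?x ` {1..5} \<union> ?y ` {1..5} = cart_basis" ..
  show ?thesis
    unfolding P.standard_basis_def basis
  proof (intro conjI)
    show "card (cart_basis :: ('f ^ 10) set) = 2 * 5"
      by (simp add: card_cart_basis)
    show "\<forall>i\<in>{1..5}. \<forall>j\<in>{1..5}. P_form (?x i) (?x j) = 0 \<and> P_form (?y i) (?y j) = 0 \<and>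
        P_form (?x i) (?y j) = (if i = j then 1 else 0)"
      unfolding I by (simp add: P_form_def axis_def)
  qed (rule independent_cart_basis span_cart_basis)+
qed

lemma P_presented_by:
  "symplectic_alternating_algebra.presented_by ((*s) :: 'f::field \<Rightarrow> 'f ^ 10 \<Rightarrow> 'f ^ 10) P_form P_mul 5 P_10_4_2"
proof -
  let ?b = "basis_vector (\<lambda>i. axis (of_nat i - 1 :: 10) (1 :: 'f)) (\<lambda>i. axis (of_nat i + 4) 1)"
  let ?labels = "X ` {1..5} \<union> Y ` {1..5}"
  have I: "{1..5} = {1, 2, 3, 4, 5 :: nat}" by auto
  \<comment> \<open>Only the six coordinates that enter triple values. The restriction to
    \<open>?labels\<close> matters, since indices of type \<open>10\<close> are read modulo
    10.\<close>
  have b: "?b p $ 0 = of_bool (p = X 1)" "?b p $ 5 = of_bool (p = Y 1)" "?b p $ 6 = of_bool (p = Y 2)"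
    "?b p $ 7 = of_bool (p = Y 3)" "?b p $ 8 = of_bool (p = Y 4)" "?b p $ 9 = of_bool (p = Y 5)"
    if "p \<in> ?labels" for p
    using that unfolding I image_insert image_empty Un_insert_left Un_empty_left
    by (elim insertE emptyE; simp add: axis_def)+
  \<comment> \<open>The twelve monomials are the six signed rearrangements of each listed triple, so
    on basis vectors a monomial can be nonzero only for labels forming one of the two listed
    multisets.\<close>
  have T: "P_form (P_mul u v) w =
      u $ 0 * v $ 6 * w $ 7 - u $ 0 * v $ 7 * w $ 6 + u $ 6 * v $ 7 * w $ 0 - u $ 6 * v $ 0 * w $ 7
    + u $ 7 * v $ 0 * w $ 6 - u $ 7 * v $ 6 * w $ 0
    + (u $ 5 * v $ 8 * w $ 9 - u $ 5 * v $ 9 * w $ 8 + u $ 8 * v $ 9 * w $ 5 - u $ 8 * v $ 5 * w $ 9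
    + u $ 9 * v $ 5 * w $ 8 - u $ 9 * v $ 8 * w $ 5)" for u v w :: "'f ^ 10"
    by (simp add: P_form_def P_mul_def algebra_simps)
  have zero: "P_form (P_mul (?b p) (?b q)) (?b r) = 0"
    if "p \<in> ?labels" "q \<in> ?labels" "r \<in> ?labels"
      and "{#p, q, r#} \<noteq> {#X 1, Y 2, Y 3#}" "{#p, q, r#} \<noteq> {#Y 1, Y 4, Y 5#}" for p q r
  proof -
    have neq: "\<not> (p = a \<and> q = b \<and> r = c)"
      if "{#a, b, c#} = {#X 1, Y 2, Y 3#} \<or> {#a, b, c#} = {#Y 1, Y 4, Y 5#}" for a b c
      using that \<open>{#p, q, r#} \<noteq> {#X 1, Y 2, Y 3#}\<close> \<open>{#p, q, r#} \<noteq> {#Y 1, Y 4, Y 5#}\<close> by metis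
    have prod: "of_bool (p = a) * of_bool (q = b) * of_bool (r = c) = (0 :: 'f)"
      if "{#a, b, c#} = {#X 1, Y 2, Y 3#} \<or> {#a, b, c#} = {#Y 1, Y 4, Y 5#}" for a b c
      using neq[OF that] by auto
    show ?thesis
      unfolding T b[OF that(1)] b[OF that(2)] b[OF that(3)]
      by (subst prod, simp add: add_mset_commute)+ simp
  qed
  have "P_form (P_mul (?b (X 1)) (?b (Y 2))) (?b (Y 3)) = 1"
    "P_form (P_mul (?b (Y 1)) (?b (Y 4))) (?b (Y 5)) = 1"
    unfolding T by (simp_all add: axis_def)
  then have "\<forall>((p, q, r), c) \<in> P_10_4_2. P_form (P_mul (?b p) (?b q)) (?b r) = c"
    unfolding P_10_4_2_def by (simp only: ball_simps case_prod_conv simp_thms)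
  moreover have "\<forall>p\<in>?labels. \<forall>q\<in>?labels. \<forall>r\<in>?labels.
      (\<forall>((p', q', r'), c) \<in> (P_10_4_2 :: 'f presentation). {#p, q, r#} \<noteq> {#p', q', r'#}) \<longrightarrow>
      P_form (P_mul (?b p) (?b q)) (?b r) = 0"
    unfolding P_10_4_2_def using zero by (simp only: ball_simps case_prod_conv) blast
  ultimately show ?thesis
    unfolding P.presented_by_def Let_def using P_standard_basis by blast
qed

section \<open>Multiplication table and coordinate isomorphism\<close>

context P_10_4_2_basis
begin

lemmas gram = form_x1 form_x2 form_x3 form_x4 form_x5 form_y

lemmas gram_swap = gram[THEN form_swap_value]

text \<open>The x_i and y_i are dual to each other, and the difference of both sides is orthogonal
  to a spanning set.\<close>

lemma basis_expansion:
  "u = scale (form u y1) x1 + scale (form u y2) x2 + scale (form u y3) x3 + scale (form u y4) x4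
    + scale (form u y5) x5 + scale (form x1 u) y1 + scale (form x2 u) y2 + scale (form x3 u) y3
    + scale (form x4 u) y4 + scale (form x5 u) y5" (is "u = ?e")
proof -
  let ?S = "{x1, x2, x3, x4, x5, y1, y2, y3, y4, y5}"
  have y_u: "form y1 u = - form u y1" "form y2 u = - form u y2" "form y3 u = - form u y3"
    "form y4 u = - form u y4" "form y5 u = - form u y5"
    by (rule form_skew)+
  have "form s (u - ?e) = 0" if "s \<in> ?S" for s
    using that
    by (elim insertE emptyE)
      (simp_all add: form_linear gram gram_swap form_alternating y_u)
  then have "form v (u - ?e) = 0" for v
    using perp_span_left[of ?S "u - ?e" v] span_basis by auto
  then have "form (u - ?e) v = 0" for v
    using form_skew[of "u - ?e" v] by simp
  then show ?thesis
    using form_nondegenerate[of "u - ?e"] by simp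
qed

lemma form_expansion:
  "form u v = form u y1 * form x1 v + form u y2 * form x2 v + form u y3 * form x3 v
    + form u y4 * form x4 v + form u y5 * form x5 v - form x1 u * form v y1 - form x2 u * form v y2
    - form x3 u * form v y3 - form x4 u * form v y4 - form x5 u * form v y5"
proof -
  have "form y1 v = - form v y1" "form y2 v = - form v y2" "form y3 v = - form v y3"
    "form y4 v = - form v y4" "form y5 v = - form v y5"
    by (rule form_skew)+
  then show ?thesis
    by (subst basis_expansion[of u]) (simp add: form_linear)
qed

lemma x1_mul: "x1 \<star> u = scale (form x2 u) x3 - scale (form x3 u) x2"
  by (subst basis_expansion[of u])
    (simp add: mul_linear mul_x1 mul_alternating centerD x2_center x3_center x4_center x5_center)

lemma y1_mul: "y1 \<star> u = scale (form x4 u) x5 - scale (form x5 u) x4"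
proof -
  have "y1 \<star> x1 = 0"
    using mul_skew[of y1 x1] mul_x1 by simp
  then show ?thesis
    by (subst basis_expansion[of u])
      (simp add: mul_linear mul_y1 mul_alternating centerD x2_center x3_center x4_center x5_center)
qed

lemma form_mul_center: "c \<in> center \<Longrightarrow> form c (u \<star> v) = 0"
  using center_iff_perp_lower_central_2[of c] mul_in_lower_central_2 form_eq_swap[of "u \<star> v" c 0]
  by simp

lemma form_x1_mul: "form x1 (u \<star> v) = form x3 u * form x2 v - form x2 u * form x3 v"
proof -
  have "form (u \<star> v) x1 = form x2 u * form x3 v - form x3 u * form x2 v"
    using form_mul_cyclic[of x1 u v] by (simp add: x1_mul form_linear)
  then show ?thesis
    by (simp add: form_skew[of x1 "u \<star> v"])
qed

text \<open>Products are orthogonal to the central vectors \<open>x2\<close> to \<open>x5\<close>,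
  so \<open>y2\<close> to \<open>y5\<close> do not occur; the cyclic identity reads the coefficients
  of \<open>x1\<close> and \<open>y1\<close> from the rows of \<open>y1\<close> and
  \<open>x1\<close>.\<close>

lemma mul_formula:
  "u \<star> v = scale (form x4 u * form x5 v - form x5 u * form x4 v) x1
    + scale (form (u \<star> v) y2) x2 + scale (form (u \<star> v) y3) x3
    + scale (form (u \<star> v) y4) x4 + scale (form (u \<star> v) y5) x5
    + scale (form x3 u * form x2 v - form x2 u * form x3 v) y1"
proof -
  have "form (u \<star> v) y1 = form x4 u * form x5 v - form x5 u * form x4 v"
    using form_mul_cyclic[of y1 u v] by (simp add: y1_mul form_linear)
  then show ?thesis
    using basis_expansion[of "u \<star> v"]
    by (simp add: form_x1_mul form_mul_center x2_center x3_center x4_center x5_center)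
qed

lemma y_mul_x1: "y2 \<star> x1 = - x3" "y3 \<star> x1 = x2" "y4 \<star> x1 = 0" "y5 \<star> x1 = 0"
  using mul_skew[of y2 x1] mul_skew[of y3 x1] mul_skew[of y4 x1] mul_skew[of y5 x1] mul_x1
  by simp_all

lemma y_mul_y1: "y2 \<star> y1 = 0" "y3 \<star> y1 = 0" "y4 \<star> y1 = - x5" "y5 \<star> y1 = x4"
  using mul_skew[of y2 y1] mul_skew[of y3 y1] mul_skew[of y4 y1] mul_skew[of y5 y1] mul_y1
  by simp_all

lemma form_mul_y_rotated:
  "form (y2 \<star> y4) y3 = 0" "form (y2 \<star> y5) y3 = 0" "form (y3 \<star> y4) y2 = 0" "form (y3 \<star> y5) y2 = 0"
  "form (y2 \<star> y4) y5 = 0" "form (y2 \<star> y5) y4 = 0" "form (y3 \<star> y4) y5 = 0" "form (y3 \<star> y5) y4 = 0"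
  using form_mul_y form_mul_swap[of y2 y4 y3] form_mul_swap[of y2 y5 y3] form_mul_cyclic[of y2 y3 y4]
    form_mul_cyclic[of y2 y3 y5] form_mul_swap[of y2 y5 y4] form_mul_swap[of y3 y5 y4]
    form_mul_cyclic[of y2 y4 y5] form_mul_cyclic[of y3 y4 y5]
  by simp_all

lemma form_mul_self: "form (u \<star> v) u = 0" "form (u \<star> v) v = 0"
  using form_mul_cyclic[of u v v] form_mul_cyclic[of u u v] form_mul_cyclic[of v u u]
  by (simp_all add: mul_alternating)

text \<open>The two nonzero entries come from (y_2y_3,x_1) = (x_1y_2,y_3) = 1 and (y_4y_5,y_1) =
  (y_1y_4,y_5) = 1.\<close>

lemma y_mul_y: "y2 \<star> y3 = - y1" "y4 \<star> y5 = x1" "y2 \<star> y4 = 0" "y2 \<star> y5 = 0" "y3 \<star> y4 = 0" "y3 \<star> y5 = 0"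
  by (subst mul_formula, simp add: gram gram_swap form_mul_y form_mul_y_rotated form_mul_self)+

lemma y_mul:
  "y2 \<star> u = - scale (form u y1) x3 - scale (form x3 u) y1"
  "y3 \<star> u = scale (form u y1) x2 + scale (form x2 u) y1"
  "y4 \<star> u = scale (form x5 u) x1 - scale (form x1 u) x5"
  "y5 \<star> u = scale (form x1 u) x4 - scale (form x4 u) x1"
proof -
  have swapped: "y3 \<star> y2 = y1" "y5 \<star> y4 = - x1" "y4 \<star> y2 = 0" "y5 \<star> y2 = 0" "y4 \<star> y3 = 0" "y5 \<star> y3 = 0"
    using mul_skew[of y3 y2] mul_skew[of y5 y4] mul_skew[of y4 y2] mul_skew[of y5 y2]
      mul_skew[of y4 y3] mul_skew[of y5 y3] y_mul_y by simp_all
  show "y2 \<star> u = - scale (form u y1) x3 - scale (form x3 u) y1"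
    "y3 \<star> u = scale (form u y1) x2 + scale (form x2 u) y1"
    "y4 \<star> u = scale (form x5 u) x1 - scale (form x1 u) x5"
    "y5 \<star> u = scale (form x1 u) x4 - scale (form x4 u) x1"
    by (subst basis_expansion[of u], simp add: mul_linear y_mul_x1 y_mul_y1 y_mul_y swapped
        mul_alternating centerD x2_center x3_center x4_center x5_center)+
qed

text \<open>The coefficients of \<open>basis_expansion\<close>, in the order of the coordinate
  algebra.\<close>

definition coords where
  "coords u = vec10 (form u y1) (form u y2) (form u y3) (form u y4) (form u y5)
    (form x1 u) (form x2 u) (form x3 u) (form x4 u) (form x5 u)"

lemma form_coords: "P_form (coords u) (coords v) = form u v"
  by (subst form_expansion[of u v]) (simp add: P_form_def coords_def)

text \<open>The coordinates along the x_i are (uv,y_i) = (y_iu,v), so the rows of \<open>y1\<close>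
  to \<open>y5\<close> supply them.\<close>

lemma coords_mul: "coords (u \<star> v) = P_mul (coords u) (coords v)"
proof -
  have y_v: "form y1 v = - form v y1"
    by (rule form_skew)
  show ?thesis
    using form_mul_cyclic[of y1 u v] form_mul_cyclic[of y2 u v] form_mul_cyclic[of y3 u v]
      form_mul_cyclic[of y4 u v] form_mul_cyclic[of y5 u v]
    by (simp add: coords_def P_mul_def vec10_eq_iff form_x1_mul form_mul_center x2_center x3_center
        x4_center x5_center y1_mul y_mul form_linear y_v)
qed

lemma linear_coords: "Vector_Spaces.linear scale (*s) coords"
  by unfold_locales (simp_all add: coords_def vec10_eq_iff form_linear)

lemma bij_coords: "bij coords"
proof (rule bijI)
  show "inj coords"
  proof (rule injI)
    fix u v assume "coords u = coords v"
    then show "u = v"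
      using basis_expansion[of u] basis_expansion[of v]
      by (simp add: coords_def vec10_eq_iff)
  qed
  show "surj coords"
  proof (rule surjI)
    fix a
    show "coords (scale (a $ 0) x1 + scale (a $ 1) x2 + scale (a $ 2) x3 + scale (a $ 3) x4
      + scale (a $ 4) x5 + scale (a $ 5) y1 + scale (a $ 6) y2 + scale (a $ 7) y3
      + scale (a $ 8) y4 + scale (a $ 9) y5) = a"
      by (simp add: coords_def vec10_eq_iff form_linear gram gram_swap form_alternating)
  qed
qed

lemma isomorphic_P: "saa_isomorphic scale form mul (*s) P_form P_mul"
  unfolding saa_isomorphic_def
  using linear_coords bij_coords coords_mul form_coords by blast

end

text \<open>Uniqueness takes the form of an isomorphism from every such algebra, on an arbitrary
  carrier type, onto one fixed algebra; any two are then isomorphic through it.\<close>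

theorem proposition2p2:
  "\<exists>(form :: 'f::field ^ 10 \<Rightarrow> 'f ^ 10 \<Rightarrow> 'f) (mul :: 'f ^ 10 \<Rightarrow> 'f ^ 10 \<Rightarrow> 'f ^ 10).
     nilpotent_saa_10_4_type_A (*s) form mul \<and>
     symplectic_alternating_algebra.presented_by (*s) form mul 5 P_10_4_2 \<and>
     (\<forall>(scale' :: 'f \<Rightarrow> 'v::ab_group_add \<Rightarrow> 'v) form' mul'.
        nilpotent_saa_10_4_type_A scale' form' mul' \<longrightarrow>
        saa_isomorphic scale' form' mul' (*s) form mul)"
proof (intro exI conjI allI impI)
  show "nilpotent_saa_10_4_type_A ((*s) :: 'f \<Rightarrow> 'f ^ 10 \<Rightarrow> 'f ^ 10) P_form P_mul"
    by (rule P_nilpotent_saa_10_4_type_A)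
  show "symplectic_alternating_algebra.presented_by ((*s) :: 'f \<Rightarrow> 'f ^ 10 \<Rightarrow> 'f ^ 10) P_form P_mul 5 P_10_4_2"
    by (rule P_presented_by)
next
  fix scale' :: "'f \<Rightarrow> 'v \<Rightarrow> 'v" and form' mul'
  assume "nilpotent_saa_10_4_type_A scale' form' mul'"
  then interpret L: nilpotent_saa_10_4_type_A scale' form' mul' .
  obtain x1 x2 x3 x4 x5 y1 y2 y3 y4 y5 where
    "P_10_4_2_basis scale' form' mul' x1 x2 x3 x4 x5 y1 y2 y3 y4 y5"
    using L.type_A_basis[OF L.third_power L.dim_center L.type_A L.isotropic_center] by blast
  then show "saa_isomorphic scale' form' mul' (*s) P_form P_mul"
    by (rule P_10_4_2_basis.isomorphic_P)
qed

end
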